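(* Let $A$ be a proper integrally closed subring of a field $F$, let $C$ be a set with $A \subsetneq C \subseteq F$, and let $\mathfrak X$ be the set of valuation rings of $F$ containing $A$. If $A = (\bigcap_{V \in X} V) \cap C$, where $X$ is a Noetherian subspace of $\mathfrak X$ with respect to the Zariski topology, then $\mathrm{gen}(X)$ contains a strongly irredundant $C$-representation of $A$ that is a Noetherian space in the Zariski topology.
   Context: "Integrally closed subring of $F$" means integrally closed in $F$. Valuation rings of $F$ are those with quotient field $F$ (including $F$ itself). The Zariski topology on $\mathfrak X$ has as a basis of open sets the sets $\{V \in \mathfrak X : x_1,\ldots,x_n \in V\}$ with $x_1,\ldots,x_n \in F$. A topological space is Noetherian if its open sets satisfy the ascending chain condition. For $X \subseteq \mathfrak X$, $\mathrm{gen}(X) = \{V \in \mathfrak X : W \subseteq V \text{ for some } W \in X\}$. A $C$-representation of $A$ is a subset $Y \subseteq \mathfrak X$ with $A = (\bigcap_{V \in Y} V) \cap C$. A member $V$ of a $C$-representation $Y$ is irredundant in $Y$ if $Y \setminus \{V\}$ is not a $C$-representation of $A$; it is strongly irredundant in $Y$ if it is irredundant in $Y$ and cannot be replaced by a proper valuation overring, i.e. there is no $W \in \mathfrak X$ with $V \subsetneq W$ such that $(Y \setminus \{V\}) \cup \{W\}$ is a $C$-representation of $A$. A $C$-representation is strongly irredundant if each of its members is strongly irredundant in it. *)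

theory Defs
  imports "HOL-Analysis.Abstract_Topology" "HOL-Algebra.Polynomials"
begin

definition integral_over :: "('a, 'b) ring_scheme \<Rightarrow> 'a set \<Rightarrow> 'a \<Rightarrow> bool" where
  "integral_over F A x \<longleftrightarrow>
    (\<exists>p. polynomial\<^bsub>F\<^esub> A p \<and> p \<noteq> [] \<and> lead_coeff p = \<one>\<^bsub>F\<^esub> \<and> ring.eval F p x = \<zero>\<^bsub>F\<^esub>)"

definition integrally_closed_in :: "('a, 'b) ring_scheme \<Rightarrow> 'a set \<Rightarrow> bool" where
  "integrally_closed_in F A \<longleftrightarrow> (\<forall>x \<in> carrier F. integral_over F A x \<longrightarrow> x \<in> A)"

text \<open>Valuation rings with quotient field \<open>F\<close>; \<open>F\<close> itself qualifies. The second conjunct forces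
  \<open>F\<close> to be the quotient field of \<open>V\<close>, see \<open>valuation_ring_of_quotient_field\<close> below.\<close>

definition valuation_ring_of :: "('a, 'b) ring_scheme \<Rightarrow> 'a set \<Rightarrow> bool" where
  "valuation_ring_of F V \<longleftrightarrow>
    subring V F \<and> (\<forall>x \<in> carrier F - {\<zero>\<^bsub>F\<^esub>}. x \<in> V \<or> inv\<^bsub>F\<^esub> x \<in> V)"

definition valuation_overrings :: "('a, 'b) ring_scheme \<Rightarrow> 'a set \<Rightarrow> 'a set set" where
  "valuation_overrings F A = {V. valuation_ring_of F V \<and> A \<subseteq> V}"

definition zariski_basis :: "('a, 'b) ring_scheme \<Rightarrow> 'a set \<Rightarrow> 'a set set set" where
  "zariski_basis F A =
    {{V \<in> valuation_overrings F A. S \<subseteq> V} | S. finite S \<and> S \<subseteq> carrier F}"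

definition zariski :: "('a, 'b) ring_scheme \<Rightarrow> 'a set \<Rightarrow> 'a set topology" where
  "zariski F A = topology_generated_by (zariski_basis F A)"

definition noetherian_space :: "'a topology \<Rightarrow> bool" where
  "noetherian_space T \<longleftrightarrow>
    (\<forall>U :: nat \<Rightarrow> 'a set. (\<forall>n. openin T (U n)) \<and> (\<forall>n. U n \<subseteq> U (Suc n))
      \<longrightarrow> (\<exists>N. \<forall>n\<ge>N. U n = U N))"

definition gen :: "('a, 'b) ring_scheme \<Rightarrow> 'a set \<Rightarrow> 'a set set \<Rightarrow> 'a set set" where
  "gen F A Xs = {V \<in> valuation_overrings F A. \<exists>W \<in> Xs. W \<subseteq> V}"

text \<open>For \<open>Y = {}\<close> the intersection over \<open>Y\<close> is \<open>UNIV\<close> here, rather than the field; as \<open>C\<close> is always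
  a subset of the field, the intersection with \<open>C\<close> is \<open>C\<close> under either convention.\<close>

definition C_representation ::
    "('a, 'b) ring_scheme \<Rightarrow> 'a set \<Rightarrow> 'a set \<Rightarrow> 'a set set \<Rightarrow> bool" where
  "C_representation F A C Y \<longleftrightarrow> Y \<subseteq> valuation_overrings F A \<and> A = \<Inter>Y \<inter> C"

definition irredundant_in ::
    "('a, 'b) ring_scheme \<Rightarrow> 'a set \<Rightarrow> 'a set \<Rightarrow> 'a set set \<Rightarrow> 'a set \<Rightarrow> bool" where
  "irredundant_in F A C Y V \<longleftrightarrow> \<not> C_representation F A C (Y - {V})"

definition strongly_irredundant_in ::
    "('a, 'b) ring_scheme \<Rightarrow> 'a set \<Rightarrow> 'a set \<Rightarrow> 'a set set \<Rightarrow> 'a set \<Rightarrow> bool" where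
  "strongly_irredundant_in F A C Y V \<longleftrightarrow>
    irredundant_in F A C Y V \<and>
    \<not> (\<exists>W \<in> valuation_overrings F A. V \<subset> W \<and> C_representation F A C ((Y - {V}) \<union> {W}))"

definition strongly_irredundant_C_representation ::
    "('a, 'b) ring_scheme \<Rightarrow> 'a set \<Rightarrow> 'a set \<Rightarrow> 'a set set \<Rightarrow> bool" where
  "strongly_irredundant_C_representation F A C Y \<longleftrightarrow>
    C_representation F A C Y \<and> (\<forall>V \<in> Y. strongly_irredundant_in F A C Y V)"

lemma valuation_ring_of_quotient_field:
  assumes "field F" and V: "valuation_ring_of F V" and x: "x \<in> carrier F"
  shows "\<exists>a \<in> V. \<exists>b \<in> V - {\<zero>\<^bsub>F\<^esub>}. x = a \<otimes>\<^bsub>F\<^esub> inv\<^bsub>F\<^esub> b"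
proof -
  interpret field F by fact
  have sub: "subring V F" using V by (simp add: valuation_ring_of_def)
  have one: "\<one>\<^bsub>F\<^esub> \<in> V" using sub by (rule subringE(3))
  show ?thesis
  proof (cases "x \<in> V")
    case True
    then show ?thesis using one x by (intro bexI[of _ x] bexI[of _ "\<one>\<^bsub>F\<^esub>"]) auto
  next
    case False
    have nz: "x \<noteq> \<zero>\<^bsub>F\<^esub>" using False subringE(2)[OF sub] by auto
    then have U: "x \<in> Units F" using x by (simp add: field_Units)
    have "inv\<^bsub>F\<^esub> x \<in> V" using V False x nz by (auto simp: valuation_ring_of_def)
    moreover have "inv\<^bsub>F\<^esub> x \<noteq> \<zero>\<^bsub>F\<^esub>" using U Units_inv_Units field_Units by auto
    moreover have "x = \<one>\<^bsub>F\<^esub> \<otimes>\<^bsub>F\<^esub> inv\<^bsub>F\<^esub> (inv\<^bsub>F\<^esub> x)" using U x by simp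
    ultimately show ?thesis using one by (intro bexI[of _ "\<one>\<^bsub>F\<^esub>"] bexI[of _ "inv\<^bsub>F\<^esub> x"]) simp_all
  qed
qed

lemma carrier_valuation_ring_of:
  assumes "field F" shows "valuation_ring_of F (carrier F)"
  using field.is_ring[OF assms] ring.carrier_is_subring[of F]
  by (auto simp: valuation_ring_of_def)

lemma topspace_zariski: "topspace (zariski F A) = valuation_overrings F A"
  unfolding zariski_def topology_generated_by_topspace zariski_basis_def
  by (auto intro!: exI[of _ "{}"])

lemma openin_zariski_iff:
  "openin (zariski F A) U \<longleftrightarrow> (\<exists>B \<subseteq> zariski_basis F A. U = \<Union>B)"
proof
  assume "openin (zariski F A) U"
  then have "generate_topology_on (zariski_basis F A) U"
    by (simp add: zariski_def openin_topology_generated_by_iff)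
  then show "\<exists>B \<subseteq> zariski_basis F A. U = \<Union>B"
  proof induction
    case Empty
    then show ?case by (intro exI[of _ "{}"]) simp
  next
    case (Int a b)
    then obtain P Q where P: "P \<subseteq> zariski_basis F A" "a = \<Union>P"
      and Q: "Q \<subseteq> zariski_basis F A" "b = \<Union>Q" by blast
    have "p \<inter> q \<in> zariski_basis F A" if pq: "p \<in> P" "q \<in> Q" for p q
    proof -
      obtain S where S: "p = {V \<in> valuation_overrings F A. S \<subseteq> V}" "finite S" "S \<subseteq> carrier F"
        using pq P unfolding zariski_basis_def by blast
      obtain T where T: "q = {V \<in> valuation_overrings F A. T \<subseteq> V}" "finite T" "T \<subseteq> carrier F"
        using pq Q unfolding zariski_basis_def by blast
      have "p \<inter> q = {V \<in> valuation_overrings F A. S \<union> T \<subseteq> V}" using S T by auto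
      then show ?thesis using S T unfolding zariski_basis_def by (intro CollectI exI[of _ "S \<union> T"]) simp
    qed
    then have "{p \<inter> q | p q. p \<in> P \<and> q \<in> Q} \<subseteq> zariski_basis F A" by blast
    moreover have "a \<inter> b = \<Union>{p \<inter> q | p q. p \<in> P \<and> q \<in> Q}" using P Q by blast
    ultimately show ?case by (intro exI conjI)
  next
    case (UN K)
    have "\<Union>K = \<Union>{b \<in> zariski_basis F A. b \<subseteq> \<Union>K}"
      using UN.IH by fast
    then show ?case by (intro exI[of _ "{b \<in> zariski_basis F A. b \<subseteq> \<Union>K}"]) simp
  next
    case (Basis s)
    then show ?case by (intro exI[of _ "{s}"]) simp
  qed
next
  assume "\<exists>B \<subseteq> zariski_basis F A. U = \<Union>B"
  then show "openin (zariski F A) U"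
    unfolding zariski_def openin_topology_generated_by_iff
    by (auto intro!: generate_topology_on.UN intro: generate_topology_on.Basis)
qed

end

theory Submission
  imports Defs
begin

text \<open>Compactness of the space of valuation rings enters through ultrafilters: the limit
  \<open>{x. \<forall>\<^sub>F V in U. x \<in> V}\<close> of an ultrafilter \<open>U\<close> on valuation rings is a valuation ring, and a set
  \<open>X\<close> of valuation rings is Noetherian iff every ultrafilter on \<open>X\<close> contains the set of those
  members of \<open>X\<close> that lie inside its limit. Since the overrings of a valuation ring form a chain,
  this criterion passes from \<open>X\<close> to every antichain in \<open>gen(X)\<close>; it also shows that \<open>gen(X)\<close> is
  closed under limits of ultrafilters. By Zorn's lemma there is a minimal \<open>G \<subseteq> gen(X)\<close> that is
  closed under limits and under overrings and is a \<open>C\<close>-representation. Its minimal members form a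
  Noetherian \<open>C\<close>-representation \<open>Y\<close> with \<open>gen(Y) = G\<close>. Dropping a member of \<open>Y\<close> or replacing it
  by a proper overring leaves a Noetherian set, whose \<open>gen\<close> is a proper subset of \<open>G\<close> closed under
  limits; so by minimality of \<open>G\<close> it is no longer a \<open>C\<close>-representation.\<close>

section \<open>Ultrafilters\<close>

text \<open>Zorn's lemma for the reversed order, with nonemptiness split off so that only nonempty
  chains need a lower bound. It serves filters, rings below a given ring, and families of
  rings.\<close>

lemma minimal_element_exists:
  fixes A :: "'a::order set"
  assumes "A \<noteq> {}"
    and chain: "\<And>C. C \<subseteq> A \<Longrightarrow> C \<noteq> {} \<Longrightarrow> (\<And>x y. x \<in> C \<Longrightarrow> y \<in> C \<Longrightarrow> x \<le> y \<or> y \<le> x)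
      \<Longrightarrow> \<exists>l\<in>A. \<forall>x\<in>C. l \<le> x"
  shows "\<exists>m\<in>A. \<forall>x\<in>A. x \<le> m \<longrightarrow> x = m"
proof (rule predicate_Zorn)
  show "partial_order_on A (relation_of (\<ge>) A)"
    by (rule partial_order_on_relation_ofI) auto
  fix C assume C: "C \<in> Chains (relation_of (\<ge>) A)"
  show "\<exists>u\<in>A. \<forall>a\<in>C. u \<le> a"
  proof (cases "C = {}")
    case False
    have "C \<subseteq> A" "\<And>x y. x \<in> C \<Longrightarrow> y \<in> C \<Longrightarrow> x \<le> y \<or> y \<le> x"
      using C unfolding Chains_def relation_of_def by auto
    with False chain show ?thesis by blast
  qed (use \<open>A \<noteq> {}\<close> in auto)
qed

text \<open>Filters live on the whole type, so an ultrafilter on a set \<open>S\<close> is one for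
  which membership in \<open>S\<close> holds eventually.\<close>

definition ultrafilter :: "'a filter \<Rightarrow> bool" where
  "ultrafilter U \<longleftrightarrow> U \<noteq> bot \<and> (\<forall>P. eventually P U \<or> eventually (\<lambda>x. \<not> P x) U)"

lemma ultrafilter_not_eventually:
  assumes "ultrafilter U"
  shows "eventually (\<lambda>x. \<not> P x) U \<longleftrightarrow> \<not> eventually P U"
proof
  assume *: "eventually (\<lambda>x. \<not> P x) U"
  show "\<not> eventually P U"
  proof
    assume "eventually P U"
    with * have "eventually (\<lambda>x. False) U"
      by eventually_elim simp
    then show False
      using assms by (simp add: ultrafilter_def eventually_False)
  qed
qed (use assms in \<open>auto simp: ultrafilter_def\<close>)

lemma ultrafilter_disj:
  assumes "ultrafilter U" and "eventually (\<lambda>x. P x \<or> Q x) U"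
  shows "eventually P U \<or> eventually Q U"
proof (rule disjCI)
  assume "\<not> eventually Q U"
  then have "eventually (\<lambda>x. \<not> Q x) U"
    using assms(1) by (simp add: ultrafilter_not_eventually)
  with assms(2) show "eventually P U"
    by eventually_elim simp
qed

lemma ultrafilter_ex:
  assumes "ultrafilter U" and "eventually P U"
  shows "\<exists>x. P x"
  using assms by (auto simp: ultrafilter_def intro: eventually_happens')

lemma ultrafilter_filtermap:
  assumes "ultrafilter U"
  shows "ultrafilter (filtermap f U)"
  using assms by (auto simp: ultrafilter_def eventually_filtermap filtermap_bot_iff)

text \<open>A minimal proper filter is an ultrafilter: unless the negation of \<open>P\<close> holds
  eventually, adjoining the set of \<open>P\<close> keeps the filter proper, and minimality puts
  that set into the filter already.\<close>

lemma ultrafilter_le_exists: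
  assumes "F \<noteq> bot"
  shows "\<exists>U\<le>F. ultrafilter U"
proof -
  let ?A = "{G. G \<noteq> bot \<and> G \<le> F}"
  have "\<exists>m\<in>?A. \<forall>x\<in>?A. x \<le> m \<longrightarrow> x = m"
  proof (rule minimal_element_exists)
    show "?A \<noteq> {}" using assms by auto
    fix C assume C: "C \<subseteq> ?A" "C \<noteq> {}" "\<And>x y. x \<in> C \<Longrightarrow> y \<in> C \<Longrightarrow> x \<le> y \<or> y \<le> x"
    \<comment> \<open>A nonempty chain is directed, so its infimum is just the union of the filters
      as families of sets; hence it is proper.\<close>
    have "eventually P (Inf C) \<longleftrightarrow> (\<exists>b\<in>C. eventually P b)" for P
    proof (rule eventually_Inf_base)
      show "\<exists>x\<in>C. x \<le> inf F' G" if "F' \<in> C" "G \<in> C" for F' G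
        using C(3)[OF that] that by (auto simp: le_inf_iff)
    qed (rule C)
    then have "Inf C \<noteq> bot"
      using C(1) by (auto simp: trivial_limit_def)
    moreover have "Inf C \<le> F"
      using C(1,2) by (auto intro: Inf_lower2)
    ultimately show "\<exists>l\<in>?A. \<forall>x\<in>C. l \<le> x"
      by (intro bexI[of _ "Inf C"]) (auto intro: Inf_lower)
  qed
  then obtain U where U: "U \<noteq> bot" "U \<le> F"
    and min: "\<And>G. G \<noteq> bot \<Longrightarrow> G \<le> F \<Longrightarrow> G \<le> U \<Longrightarrow> G = U"
    by auto
  have "eventually P U" if "\<not> eventually (\<lambda>x. \<not> P x) U" for P
  proof -
    have "inf U (principal {x. P x}) \<noteq> bot"
      using that by (simp add: trivial_limit_def eventually_inf_principal)
    then have "inf U (principal {x. P x}) = U"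
      using U by (intro min) (auto intro: le_infI1)
    then have "U \<le> principal {x. P x}"
      by (metis inf_le2)
    then show ?thesis
      by (simp add: le_principal)
  qed
  with U show ?thesis
    by (auto simp: ultrafilter_def)
qed

text \<open>A nonempty chain of nonempty sets is the base of a proper filter. All compactness
  arguments below start from such an ultrafilter.\<close>

lemma ultrafilter_chain_exists:
  assumes "\<C> \<noteq> {}" and "{} \<notin> \<C>" and "\<And>S T. S \<in> \<C> \<Longrightarrow> T \<in> \<C> \<Longrightarrow> S \<subseteq> T \<or> T \<subseteq> S"
  shows "\<exists>U. ultrafilter U \<and> (\<forall>S\<in>\<C>. eventually (\<lambda>x. x \<in> S) U)"
proof -
  let ?F = "INF S\<in>\<C>. principal S"
  have "eventually P ?F \<longleftrightarrow> (\<exists>S\<in>\<C>. eventually P (principal S))" for P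
  proof (rule eventually_INF_base)
    show "\<exists>x\<in>\<C>. principal x \<le> inf (principal S) (principal T)" if "S \<in> \<C>" "T \<in> \<C>" for S T
      using assms(3)[OF that] that by auto
  qed (rule assms)
  then have "?F \<noteq> bot"
    using assms(2) by (auto simp: trivial_limit_def eventually_principal ex_in_conv)
  then obtain U where U: "U \<le> ?F" "ultrafilter U"
    using ultrafilter_le_exists by blast
  have "eventually (\<lambda>x. x \<in> S) U" if "S \<in> \<C>" for S
    using U(1) that by (auto simp: le_INF_iff le_principal)
  with U(2) show ?thesis by blast
qed

section \<open>Limits of ultrafilters on sets of rings\<close>

text \<open>For an ultrafilter this is its limit in the product topology on the power set; on
  valuation rings that is the patch (constructible) topology.\<close>

definition ultra_limit :: "'a set filter \<Rightarrow> 'a set" where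
  "ultra_limit U = {x. eventually (\<lambda>V. x \<in> V) U}"

definition ultra_noetherian :: "'a set set \<Rightarrow> bool" where
  "ultra_noetherian \<X> \<longleftrightarrow> (\<forall>U. ultrafilter U \<longrightarrow> eventually (\<lambda>V. V \<in> \<X>) U
    \<longrightarrow> eventually (\<lambda>V. V \<subseteq> ultra_limit U) U)"

text \<open>Closedness in the product topology on the power set, expressed by ultrafilters.\<close>

definition ultra_closed :: "'a set set \<Rightarrow> bool" where
  "ultra_closed G \<longleftrightarrow> (\<forall>U. ultrafilter U \<longrightarrow> eventually (\<lambda>V. V \<in> G) U \<longrightarrow> ultra_limit U \<in> G)"

lemma mem_ultra_limit: "x \<in> ultra_limit U \<longleftrightarrow> eventually (\<lambda>V. x \<in> V) U"
  by (simp add: ultra_limit_def)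

lemma not_mem_ultra_limit:
  "ultrafilter U \<Longrightarrow> x \<notin> ultra_limit U \<longleftrightarrow> eventually (\<lambda>V. x \<notin> V) U"
  by (simp add: ultra_limit_def ultrafilter_not_eventually)

text \<open>Meant for a function \<open>f\<close> that selects below each overring a member of the
  original set.\<close>

lemma ultra_limit_filtermap_subset:
  assumes "eventually (\<lambda>W. f W \<subseteq> W) U"
  shows "ultra_limit (filtermap f U) \<subseteq> ultra_limit U"
proof
  fix x assume "x \<in> ultra_limit (filtermap f U)"
  then have "eventually (\<lambda>W. x \<in> f W) U"
    by (simp add: mem_ultra_limit eventually_filtermap)
  with assms show "x \<in> ultra_limit U"
    unfolding mem_ultra_limit by eventually_elim auto
qed

lemma ultra_noetherian_Un:
  assumes "ultra_noetherian \<X>" and "ultra_noetherian Y"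
  shows "ultra_noetherian (\<X> \<union> Y)"
  unfolding ultra_noetherian_def
proof (intro allI impI)
  fix U assume "ultrafilter U" "eventually (\<lambda>V. V \<in> \<X> \<union> Y) U"
  then show "eventually (\<lambda>V. V \<subseteq> ultra_limit U) U"
    using assms ultrafilter_disj[of U "\<lambda>V. V \<in> \<X>" "\<lambda>V. V \<in> Y"]
    by (auto simp: ultra_noetherian_def)
qed

text \<open>Only the principal ultrafilter lives on a singleton, and its limit is \<open>W\<close>
  itself.\<close>

lemma ultra_noetherian_singleton: "ultra_noetherian {W}"
  unfolding ultra_noetherian_def
proof (intro allI impI)
  fix U assume W: "eventually (\<lambda>V. V \<in> {W}) U"
  have "W \<subseteq> ultra_limit U"
  proof
    fix x assume x: "x \<in> W"
    from W show "x \<in> ultra_limit U"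
      unfolding mem_ultra_limit by eventually_elim (use x in simp)
  qed
  with W show "eventually (\<lambda>V. V \<subseteq> ultra_limit U) U"
    by (auto elim: eventually_mono)
qed

lemma ultra_noetherian_subset:
  assumes "ultra_noetherian \<X>" and "Y \<subseteq> \<X>"
  shows "ultra_noetherian Y"
  unfolding ultra_noetherian_def
proof (intro allI impI)
  fix U assume U: "ultrafilter U" and Y: "eventually (\<lambda>V. V \<in> Y) U"
  from Y have "eventually (\<lambda>V. V \<in> \<X>) U"
    by eventually_elim (use assms(2) in blast)
  with U assms(1) show "eventually (\<lambda>V. V \<subseteq> ultra_limit U) U"
    by (simp add: ultra_noetherian_def)
qed

section \<open>Compactness of sets closed under limits\<close>

lemma ultra_closed_Inter:
  assumes "\<And>G. G \<in> \<C> \<Longrightarrow> ultra_closed G"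
  shows "ultra_closed (\<Inter>\<C>)"
  unfolding ultra_closed_def
proof (intro allI impI InterI)
  fix U G assume U: "ultrafilter U" "eventually (\<lambda>V. V \<in> \<Inter>\<C>) U" and G: "G \<in> \<C>"
  have "eventually (\<lambda>V. V \<in> G) U"
    using U(2) by eventually_elim (use G in blast)
  then show "ultra_limit U \<in> G"
    using assms[OF G] U(1) by (auto simp: ultra_closed_def)
qed

text \<open>The sets of those \<open>V\<close> in \<open>G\<close> that miss \<open>x\<close> form a
  chain of nonempty sets. The limit of an ultrafilter containing all of them lies in every
  \<open>G\<close> and still misses \<open>x\<close>.\<close>

lemma ultra_closed_chain_mem:
  assumes closed: "\<And>G. G \<in> \<C> \<Longrightarrow> ultra_closed G" and "\<C> \<noteq> {}"
    and chain: "\<And>G H. G \<in> \<C> \<Longrightarrow> H \<in> \<C> \<Longrightarrow> G \<subseteq> H \<or> H \<subseteq> G"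
    and x: "\<And>G. G \<in> \<C> \<Longrightarrow> \<exists>V\<in>G. x \<notin> V"
  shows "\<exists>V\<in>\<Inter>\<C>. x \<notin> V"
proof -
  have "\<exists>U. ultrafilter U \<and> (\<forall>S\<in>(\<lambda>G. {V \<in> G. x \<notin> V}) ` \<C>. eventually (\<lambda>V. V \<in> S) U)"
  proof (rule ultrafilter_chain_exists)
    show "{} \<notin> (\<lambda>G. {V \<in> G. x \<notin> V}) ` \<C>"
      using x by (auto simp: image_iff)
    show "S \<subseteq> T \<or> T \<subseteq> S"
      if "S \<in> (\<lambda>G. {V \<in> G. x \<notin> V}) ` \<C>" "T \<in> (\<lambda>G. {V \<in> G. x \<notin> V}) ` \<C>" for S T
      using that chain by blast
  qed (use \<open>\<C> \<noteq> {}\<close> in simp)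
  then obtain U where U: "ultrafilter U"
    and ev: "\<And>G. G \<in> \<C> \<Longrightarrow> eventually (\<lambda>V. V \<in> G \<and> x \<notin> V) U"
    by auto
  have "ultra_limit U \<in> G" if "G \<in> \<C>" for G
    using closed[OF that] U ev[OF that] by (auto simp: ultra_closed_def eventually_conj_iff)
  moreover have "x \<notin> ultra_limit U"
    using \<open>\<C> \<noteq> {}\<close> ev U by (auto simp: not_mem_ultra_limit eventually_conj_iff)
  ultimately show ?thesis by blast
qed

text \<open>Zorn's lemma applies because a chain \<open>C\<close> in \<open>G\<close> has a lower
  bound in \<open>G\<close>: the limit of an ultrafilter that contains every initial segment of
  \<open>C\<close>.\<close>

lemma ultra_closed_minimal_below:
  assumes "ultra_closed G" and "V \<in> G"
  shows "\<exists>M\<in>G. M \<subseteq> V \<and> (\<forall>W\<in>G. W \<subseteq> M \<longrightarrow> W = M)"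
proof -
  let ?A = "{W \<in> G. W \<subseteq> V}"
  have "\<exists>M\<in>?A. \<forall>W\<in>?A. W \<subseteq> M \<longrightarrow> W = M"
  proof (rule minimal_element_exists)
    show "?A \<noteq> {}" using assms by auto
    fix C assume C: "C \<subseteq> ?A" "C \<noteq> {}" "\<And>x y. x \<in> C \<Longrightarrow> y \<in> C \<Longrightarrow> x \<subseteq> y \<or> y \<subseteq> x"
    have "\<exists>U. ultrafilter U \<and> (\<forall>S\<in>(\<lambda>W. {Z \<in> C. Z \<subseteq> W}) ` C. eventually (\<lambda>Z. Z \<in> S) U)"
    proof (rule ultrafilter_chain_exists)
      show "S \<subseteq> T \<or> T \<subseteq> S"
        if S: "S \<in> (\<lambda>W. {Z \<in> C. Z \<subseteq> W}) ` C" and T: "T \<in> (\<lambda>W. {Z \<in> C. Z \<subseteq> W}) ` C" for S T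
      proof -
        obtain P Q where "P \<in> C" "Q \<in> C" "S = {Z \<in> C. Z \<subseteq> P}" "T = {Z \<in> C. Z \<subseteq> Q}"
          using S T by blast
        with C(3)[of P Q] show ?thesis by auto
      qed
    qed (use C(2) in auto)
    then obtain U where U: "ultrafilter U"
      and ev: "\<And>W. W \<in> C \<Longrightarrow> eventually (\<lambda>Z. Z \<in> C \<and> Z \<subseteq> W) U"
      by auto
    have lower: "ultra_limit U \<subseteq> W" if "W \<in> C" for W
    proof
      fix x assume "x \<in> ultra_limit U"
      then have "eventually (\<lambda>Z. x \<in> Z) U"
        by (simp add: mem_ultra_limit)
      \<comment> \<open>The predicate no longer depends on \<open>Z\<close>, so holding eventually
        makes it true, as \<open>U\<close> is proper.\<close>
      with ev[OF that] have "eventually (\<lambda>Z. x \<in> W) U"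
        by eventually_elim auto
      then show "x \<in> W"
        using ultrafilter_ex[OF U] by blast
    qed
    obtain W where "W \<in> C" using C(2) by blast
    have "eventually (\<lambda>Z. Z \<in> G) U"
      using ev[OF \<open>W \<in> C\<close>] by eventually_elim (use C(1) in auto)
    then have "ultra_limit U \<in> G"
      using assms(1) U by (auto simp: ultra_closed_def)
    moreover have "ultra_limit U \<subseteq> V"
      using lower[OF \<open>W \<in> C\<close>] \<open>W \<in> C\<close> C(1) by auto
    ultimately show "\<exists>l\<in>?A. \<forall>x\<in>C. l \<subseteq> x"
      using lower by (intro bexI[of _ "ultra_limit U"]) auto
  qed
  then obtain M where M: "M \<in> ?A" and min: "\<forall>W\<in>?A. W \<subseteq> M \<longrightarrow> W = M"
    by (rule bexE)
  have "W = M" if "W \<in> G" "W \<subseteq> M" for W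
    using bspec[OF min, of W] that M by auto
  with M show ?thesis by (intro bexI[of _ M]) simp_all
qed

section \<open>Valuation rings\<close>

lemma valuation_overring_subset_carrier:
  "V \<in> valuation_overrings F A \<Longrightarrow> V \<subseteq> carrier F"
  by (auto simp: valuation_overrings_def valuation_ring_of_def dest!: subringE(1))

text \<open>If \<open>x\<close> lies only in \<open>V\<close> and \<open>y\<close> only in
  \<open>W\<close>, then \<open>R\<close> contains \<open>x/y\<close> or \<open>y/x\<close>;
  multiplying by \<open>y\<close> or \<open>x\<close> puts \<open>x\<close> into \<open>W\<close> or
  \<open>y\<close> into \<open>V\<close>.\<close>

lemma valuation_overrings_comparable:
  assumes "field F" and R: "valuation_ring_of F R"
    and V: "subring V F" "R \<subseteq> V" and W: "subring W F" "R \<subseteq> W"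
  shows "V \<subseteq> W \<or> W \<subseteq> V"
proof (rule ccontr)
  interpret field F by fact
  assume "\<not> (V \<subseteq> W \<or> W \<subseteq> V)"
  then obtain x y where x: "x \<in> V" "x \<notin> W" and y: "y \<in> W" "y \<notin> V" by blast
  have xy: "x \<in> carrier F" "y \<in> carrier F" "x \<noteq> \<zero>\<^bsub>F\<^esub>" "y \<noteq> \<zero>\<^bsub>F\<^esub>"
    using x y subringE(1,2)[OF V(1)] subringE(1,2)[OF W(1)] by auto
  then have U: "x \<in> Units F" "y \<in> Units F"
    by (auto simp: field_Units)
  let ?z = "x \<otimes>\<^bsub>F\<^esub> inv\<^bsub>F\<^esub> y"
  have zU: "?z \<in> Units F"
    using U by (intro Units_m_closed Units_inv_Units)
  then have z: "?z \<in> carrier F" "?z \<noteq> \<zero>\<^bsub>F\<^esub>"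
    using field_Units by auto
  have x_eq: "x = ?z \<otimes>\<^bsub>F\<^esub> y"
    using xy U by (simp add: m_assoc)
  have y_eq: "y = inv\<^bsub>F\<^esub> ?z \<otimes>\<^bsub>F\<^esub> x"
  proof -
    have "inv\<^bsub>F\<^esub> ?z \<otimes>\<^bsub>F\<^esub> x = inv\<^bsub>F\<^esub> ?z \<otimes>\<^bsub>F\<^esub> (?z \<otimes>\<^bsub>F\<^esub> y)"
      using x_eq by simp
    also have "\<dots> = y"
      using zU xy z by (simp add: m_assoc[symmetric])
    finally show ?thesis by simp
  qed
  from z R have "?z \<in> R \<or> inv\<^bsub>F\<^esub> ?z \<in> R"
    by (auto simp: valuation_ring_of_def)
  then show False
  proof
    assume "?z \<in> R"
    then have "?z \<otimes>\<^bsub>F\<^esub> y \<in> W"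
      using W(2) subringE(6)[OF W(1) _ y(1)] by blast
    with x_eq x show False by simp
  next
    assume "inv\<^bsub>F\<^esub> ?z \<in> R"
    then have "inv\<^bsub>F\<^esub> ?z \<otimes>\<^bsub>F\<^esub> x \<in> V"
      using V(2) subringE(6)[OF V(1) _ x(1)] by blast
    with y_eq y show False by simp
  qed
qed

text \<open>Each closure condition involves finitely many elements and so passes to the limit. The
  disjunction in the valuation property is where a mere filter would not do.\<close>

lemma ultra_limit_valuation_overring:
  assumes "field F" and U: "ultrafilter U"
    and ev: "eventually (\<lambda>V. V \<in> valuation_overrings F A) U"
  shows "ultra_limit U \<in> valuation_overrings F A"
proof -
  interpret field F by fact
  have ev': "eventually (\<lambda>V. subring V F \<and> A \<subseteq> V
      \<and> (\<forall>x \<in> carrier F - {\<zero>\<^bsub>F\<^esub>}. x \<in> V \<or> inv\<^bsub>F\<^esub> x \<in> V)) U"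
    using ev by eventually_elim (auto simp: valuation_overrings_def valuation_ring_of_def)
  have "subring (ultra_limit U) F"
  proof (rule subringI)
    show "ultra_limit U \<subseteq> carrier F"
    proof
      fix x assume "x \<in> ultra_limit U"
      then have "eventually (\<lambda>V. x \<in> V) U" by (simp add: mem_ultra_limit)
      with ev' have "eventually (\<lambda>V. x \<in> carrier F) U"
        by eventually_elim (auto dest: subringE(1))
      then show "x \<in> carrier F" using ultrafilter_ex[OF U] by blast
    qed
    show "\<one>\<^bsub>F\<^esub> \<in> ultra_limit U"
      unfolding mem_ultra_limit using ev' by eventually_elim (auto dest: subringE(3))
  next
    fix h assume "h \<in> ultra_limit U"
    with ev' show "\<ominus>\<^bsub>F\<^esub> h \<in> ultra_limit U"
      unfolding mem_ultra_limit by eventually_elim (auto dest: subringE(5))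
  next
    fix h k assume "h \<in> ultra_limit U" "k \<in> ultra_limit U"
    with ev' show "h \<otimes>\<^bsub>F\<^esub> k \<in> ultra_limit U" "h \<oplus>\<^bsub>F\<^esub> k \<in> ultra_limit U"
      unfolding mem_ultra_limit
      by (eventually_elim, auto dest: subringE(6) subringE(7))+
  qed
  moreover have "A \<subseteq> ultra_limit U"
  proof
    fix x assume "x \<in> A"
    with ev' show "x \<in> ultra_limit U"
      unfolding mem_ultra_limit by (auto elim!: eventually_mono)
  qed
  moreover have "x \<in> ultra_limit U \<or> inv\<^bsub>F\<^esub> x \<in> ultra_limit U"
    if "x \<in> carrier F - {\<zero>\<^bsub>F\<^esub>}" for x
    unfolding mem_ultra_limit
    using that ev' by (intro ultrafilter_disj[OF U]) (auto elim!: eventually_mono)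
  ultimately show ?thesis
    by (auto simp: valuation_overrings_def valuation_ring_of_def)
qed

section \<open>Noetherian subspaces of the Zariski topology in terms of ultrafilters\<close>

lemma openin_zariski_meets:
  assumes "S \<subseteq> carrier F"
  shows "openin (zariski F A) {V \<in> valuation_overrings F A. V \<inter> S \<noteq> {}}"
proof -
  have "{V \<in> valuation_overrings F A. V \<inter> S \<noteq> {}}
      = \<Union>((\<lambda>x. {V \<in> valuation_overrings F A. {x} \<subseteq> V}) ` S)"
    by auto
  moreover have "(\<lambda>x. {V \<in> valuation_overrings F A. {x} \<subseteq> V}) ` S \<subseteq> zariski_basis F A"
    using assms unfolding zariski_basis_def by blast
  ultimately show ?thesis
    unfolding openin_zariski_iff by blast
qed

text \<open>If the criterion fails for \<open>U\<close>, dependent choice gives growing finite sets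
  \<open>f n\<close> outside the limit such that some member of \<open>\<X>\<close> misses
  \<open>f n\<close> but meets \<open>f (Suc n)\<close>. The open sets of rings meeting
  \<open>f n\<close> then ascend strictly.\<close>

lemma noetherian_imp_ultra_noetherian:
  assumes \<X>: "\<X> \<subseteq> valuation_overrings F A"
    and noeth: "noetherian_space (subtopology (zariski F A) \<X>)"
  shows "ultra_noetherian \<X>"
  unfolding ultra_noetherian_def
proof (intro allI impI, rule ccontr)
  fix U assume U: "ultrafilter U" and ev: "eventually (\<lambda>V. V \<in> \<X>) U"
    and not: "\<not> eventually (\<lambda>V. V \<subseteq> ultra_limit U) U"
  have step: "\<exists>T. (finite T \<and> T \<subseteq> carrier F - ultra_limit U) \<and> S \<subseteq> T
      \<and> (\<exists>V\<in>\<X>. V \<inter> S = {} \<and> V \<inter> T \<noteq> {})"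
    if S: "finite S \<and> S \<subseteq> carrier F - ultra_limit U" for S
  proof -
    \<comment> \<open>Finiteness of \<open>S\<close> is what allows the conditions for its single
      elements to be combined.\<close>
    have "eventually (\<lambda>V. \<forall>x\<in>S. x \<notin> V) U"
      using S not_mem_ultra_limit[OF U] by (intro eventually_ball_finite) auto
    moreover have "eventually (\<lambda>V. \<not> V \<subseteq> ultra_limit U) U"
      using not U by (simp add: ultrafilter_not_eventually)
    ultimately have "eventually (\<lambda>V. V \<in> \<X> \<and> V \<inter> S = {} \<and> \<not> V \<subseteq> ultra_limit U) U"
      using ev by eventually_elim auto
    then obtain V x where V: "V \<in> \<X>" "V \<inter> S = {}" "x \<in> V" "x \<notin> ultra_limit U"
      using ultrafilter_ex[OF U] by blast
    then have "x \<in> carrier F"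
      using \<X> valuation_overring_subset_carrier by blast
    with V S show ?thesis
      by (intro exI[of _ "insert x S"]) auto
  qed
  have "\<exists>f. \<forall>n::nat. (finite (f n) \<and> f n \<subseteq> carrier F - ultra_limit U)
      \<and> (f n \<subseteq> f (Suc n) \<and> (\<exists>V\<in>\<X>. V \<inter> f n = {} \<and> V \<inter> f (Suc n) \<noteq> {}))"
    by (rule dependent_nat_choice) (use step in auto)
  then obtain f :: "nat \<Rightarrow> 'a set" where f: "\<And>n. f n \<subseteq> carrier F" "\<And>n. f n \<subseteq> f (Suc n)"
    "\<And>n. \<exists>V\<in>\<X>. V \<inter> f n = {} \<and> V \<inter> f (Suc n) \<noteq> {}"
    by blast
  let ?O = "\<lambda>n. {V \<in> valuation_overrings F A. V \<inter> f n \<noteq> {}} \<inter> \<X>"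
  have "openin (subtopology (zariski F A) \<X>) (?O n)" for n
    unfolding openin_subtopology using openin_zariski_meets[OF f(1)] by blast
  moreover have "?O n \<subseteq> ?O (Suc n)" for n
    using f(2)[of n] by auto
  ultimately have "\<exists>N. \<forall>n\<ge>N. ?O n = ?O N"
    using spec[OF noeth[unfolded noetherian_space_def], of ?O] by simp
  then obtain N where N: "\<forall>n\<ge>N. ?O n = ?O N" ..
  from f(3)[of N] obtain V where "V \<in> \<X>" "V \<inter> f N = {}" "V \<inter> f (Suc N) \<noteq> {}"
    by blast
  then have "V \<in> ?O (Suc N)" "V \<notin> ?O N"
    using \<X> by auto
  moreover have "?O (Suc N) = ?O N"
    by (rule N[rule_format]) simp
  ultimately show False by blast
qed

text \<open>For a chain that never stabilizes, some ultrafilter contains the union of all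
  \<open>Op n\<close> minus each \<open>Op N\<close>. The criterion puts some \<open>V\<close> of an
  \<open>Op N\<close> inside its limit, which forces almost all rings into
  \<open>Op N\<close>.\<close>

lemma ultra_noetherian_imp_noetherian:
  fixes \<X> :: "'a set set"
  assumes \<X>: "\<X> \<subseteq> valuation_overrings F A" and un: "ultra_noetherian \<X>"
  shows "noetherian_space (subtopology (zariski F A) \<X>)"
  unfolding noetherian_space_def
proof (intro allI impI, rule ccontr, elim conjE)
  fix Op :: "nat \<Rightarrow> 'a set set"
  assume op: "\<forall>n. openin (subtopology (zariski F A) \<X>) (Op n)" and Suc: "\<forall>n. Op n \<subseteq> Op (Suc n)"
    and not: "\<nexists>N. \<forall>n\<ge>N. Op n = Op N"
  have mono: "Op m \<subseteq> Op n" if "m \<le> n" for m n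
    by (rule lift_Suc_mono_le) (use Suc that in auto)
  have nonempty: "\<Union>(range Op) - Op N \<noteq> {}" for N
  proof
    assume "\<Union>(range Op) - Op N = {}"
    then have "Op n \<subseteq> Op N" for n
      by blast
    then have "\<forall>n\<ge>N. Op n = Op N"
      using mono by (simp add: subset_antisym)
    then have "\<exists>N. \<forall>n\<ge>N. Op n = Op N" ..
    with not show False ..
  qed
  have "\<exists>U. ultrafilter U \<and>
      (\<forall>S\<in>range (\<lambda>N. \<Union>(range Op) - Op N). eventually (\<lambda>V. V \<in> S) U)"
  proof (rule ultrafilter_chain_exists)
    show "{} \<notin> range (\<lambda>N. \<Union>(range Op) - Op N)"
      using nonempty by (metis rangeE)
    fix S T
    assume "S \<in> range (\<lambda>N. \<Union>(range Op) - Op N)" "T \<in> range (\<lambda>N. \<Union>(range Op) - Op N)"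
    then obtain m n where mn: "S = \<Union>(range Op) - Op m" "T = \<Union>(range Op) - Op n"
      by blast
    have "Op m \<subseteq> Op n \<or> Op n \<subseteq> Op m"
      using mono nat_le_linear by metis
    then show "S \<subseteq> T \<or> T \<subseteq> S"
      unfolding mn by blast
  qed simp
  then obtain U where U: "ultrafilter U"
    and ev: "\<And>N. eventually (\<lambda>V. V \<in> \<Union>(range Op) - Op N) U"
    by auto
  have OX: "Op n \<subseteq> \<X>" for n
    using op openin_subset[of "subtopology (zariski F A) \<X>" "Op n"] by (auto simp: topspace_subtopology)
  have evX: "eventually (\<lambda>V. V \<in> \<X>) U"
    using ev[of 0] by eventually_elim (use OX in auto)
  then have "eventually (\<lambda>V. V \<subseteq> ultra_limit U) U"
    using un U by (simp add: ultra_noetherian_def)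
  with ev[of 0] have "eventually (\<lambda>V. V \<in> \<Union>(range Op) \<and> V \<subseteq> ultra_limit U) U"
    by eventually_elim auto
  then obtain V N where V: "V \<in> Op N" "V \<subseteq> ultra_limit U"
    using ultrafilter_ex[OF U] by blast
  obtain T where T: "openin (zariski F A) T" "Op N = T \<inter> \<X>"
    using op[rule_format, of N] unfolding openin_subtopology by blast
  then obtain B where B: "B \<subseteq> zariski_basis F A" "Op N = \<Union>B \<inter> \<X>"
    unfolding openin_zariski_iff by blast
  with V(1) obtain b where b: "b \<in> B" "V \<in> b"
    by blast
  then have "b \<in> zariski_basis F A"
    using B(1) by blast
  then obtain S where S: "finite S" "b = {V \<in> valuation_overrings F A. S \<subseteq> V}"
    unfolding zariski_basis_def by blast
  \<comment> \<open>The finite set \<open>S\<close> defines a basic neighbourhood of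
    \<open>V\<close>. As \<open>S\<close> lies in \<open>V\<close> and hence in the limit, almost
    all rings belong to this neighbourhood.\<close>
  have "eventually (\<lambda>W. \<forall>x\<in>S. x \<in> W) U"
    using S b(2) V(2) by (intro eventually_ball_finite) (auto simp: mem_ultra_limit[symmetric])
  with evX have "eventually (\<lambda>W. W \<in> Op N) U"
    by eventually_elim (use S(2) b(1) B(2) \<X> in blast)
  with ev[of N] have "eventually (\<lambda>W. False) U"
    by eventually_elim auto
  then show False
    using ultrafilter_ex[OF U] by blast
qed

section \<open>Overrings of a Noetherian set of valuation rings\<close>

lemma gen_select: "\<exists>f. \<forall>V\<in>gen F A \<X>. f V \<in> \<X> \<and> f V \<subseteq> V"
  by (rule bchoice) (auto simp: gen_def)

text \<open>Push \<open>U\<close> forward to \<open>\<X>\<close> by selecting a smaller member. Some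
  \<open>V\<close> in \<open>\<X>\<close> lies in the limit of the image, hence in the limit of
  \<open>U\<close>.\<close>

lemma ultra_closed_gen:
  assumes "field F" and "ultra_noetherian \<X>"
  shows "ultra_closed (gen F A \<X>)"
  unfolding ultra_closed_def
proof (intro allI impI)
  fix U assume U: "ultrafilter U" and ev: "eventually (\<lambda>V. V \<in> gen F A \<X>) U"
  obtain f where f: "\<forall>V\<in>gen F A \<X>. f V \<in> \<X> \<and> f V \<subseteq> V"
    using gen_select[of F A \<X>] by (rule exE)
  let ?U = "filtermap f U"
  have U': "ultrafilter ?U" using U by (rule ultrafilter_filtermap)
  have evX: "eventually (\<lambda>V. V \<in> \<X>) ?U"
    unfolding eventually_filtermap using ev by eventually_elim (use f in auto)
  then have "eventually (\<lambda>V. V \<subseteq> ultra_limit ?U) ?U"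
    using assms(2) U' by (auto simp: ultra_noetherian_def)
  with evX obtain V where V: "V \<in> \<X>" "V \<subseteq> ultra_limit ?U"
    using ultrafilter_ex[OF U', of "\<lambda>V. V \<in> \<X> \<and> V \<subseteq> ultra_limit ?U"]
    by (auto simp: eventually_conj_iff)
  have "eventually (\<lambda>W. f W \<subseteq> W) U"
    using ev by eventually_elim (use f in auto)
  then have "ultra_limit ?U \<subseteq> ultra_limit U"
    by (rule ultra_limit_filtermap_subset)
  moreover have "ultra_limit U \<in> valuation_overrings F A"
    using ev by (intro ultra_limit_valuation_overring assms U) (auto simp: gen_def elim: eventually_mono)
  ultimately show "ultra_limit U \<in> gen F A \<X>"
    using V by (auto simp: gen_def)
qed

lemma ultra_noetherian_antichain:
  assumes "field F" and \<X>: "\<X> \<subseteq> valuation_overrings F A" and un: "ultra_noetherian \<X>"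
    and Y: "Y \<subseteq> gen F A \<X>" and anti: "\<And>V W. V \<in> Y \<Longrightarrow> W \<in> Y \<Longrightarrow> V \<subseteq> W \<Longrightarrow> V = W"
  shows "ultra_noetherian Y"
  unfolding ultra_noetherian_def
proof (intro allI impI)
  fix U assume U: "ultrafilter U" and ev: "eventually (\<lambda>V. V \<in> Y) U"
  obtain f where "\<forall>V\<in>gen F A \<X>. f V \<in> \<X> \<and> f V \<subseteq> V"
    using gen_select[of F A \<X>] by (rule exE)
  then have f: "f V \<in> \<X>" "f V \<subseteq> V" if "V \<in> Y" for V
    using that Y by auto
  let ?U = "filtermap f U"
  let ?L = "ultra_limit ?U"
  have U': "ultrafilter ?U" using U by (rule ultrafilter_filtermap)
  have evX: "eventually (\<lambda>V. V \<in> \<X>) ?U"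
    unfolding eventually_filtermap using ev by eventually_elim (use f in auto)
  then have evL: "eventually (\<lambda>W. f W \<subseteq> ?L) U"
    using un U' by (auto simp: ultra_noetherian_def eventually_filtermap)
  have "eventually (\<lambda>W. f W \<subseteq> W) U"
    using ev by eventually_elim (use f in auto)
  then have LM: "?L \<subseteq> ultra_limit U"
    by (rule ultra_limit_filtermap_subset)
  have "?L \<in> valuation_overrings F A"
    using evX \<X> by (intro ultra_limit_valuation_overring assms U') (auto elim: eventually_mono)
  then have L: "subring ?L F"
    by (auto simp: valuation_overrings_def valuation_ring_of_def)
  \<comment> \<open>Almost always \<open>W\<close> and \<open>?L\<close> both contain the valuation
    ring \<open>f W\<close>, so they are comparable.\<close>
  have "eventually (\<lambda>W. W \<subseteq> ?L \<or> ?L \<subseteq> W) U"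
    using ev evL
  proof eventually_elim
    case (elim W)
    then have "f W \<in> valuation_overrings F A" "W \<in> valuation_overrings F A"
      using f \<X> Y by (auto simp: gen_def)
    then show ?case
      using elim f L by (intro valuation_overrings_comparable[OF \<open>field F\<close>, of "f W"])
        (auto simp: valuation_overrings_def valuation_ring_of_def)
  qed
  then consider "eventually (\<lambda>W. W \<subseteq> ?L) U" | "eventually (\<lambda>W. ?L \<subseteq> W) U"
    using ultrafilter_disj[OF U, of "\<lambda>W. W \<subseteq> ?L" "\<lambda>W. ?L \<subseteq> W"] by blast
  then show "eventually (\<lambda>V. V \<subseteq> ultra_limit U) U"
  proof cases
    case 1
    then show ?thesis by eventually_elim (use LM in auto)
  next
    case 2
    then have ev2: "eventually (\<lambda>W. W \<in> Y \<and> ?L \<subseteq> W \<and> f W \<subseteq> ?L) U"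
      using ev evL by eventually_elim auto
    then obtain W where W: "W \<in> Y" "?L \<subseteq> W" "f W \<subseteq> ?L"
      using ultrafilter_ex[OF U] by blast
    \<comment> \<open>Almost every \<open>V\<close> contains \<open>?L\<close> and thereby
      \<open>f W\<close>, so it is comparable with \<open>W\<close>. In an antichain this means
      equality, so \<open>U\<close> is principal.\<close>
    have "eventually (\<lambda>V. V \<in> {W}) U"
      using ev2
    proof eventually_elim
      case (elim V)
      have "f W \<in> valuation_overrings F A"
        using W f \<X> by auto
      then have "V \<subseteq> W \<or> W \<subseteq> V"
        using elim W Y by (intro valuation_overrings_comparable[OF \<open>field F\<close>, of "f W"])
          (auto simp: valuation_overrings_def valuation_ring_of_def gen_def)
      then show ?case using anti W elim by auto
    qed
    then show ?thesis
      using ultra_noetherian_singleton[of W] U by (auto simp: ultra_noetherian_def)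
  qed
qed

section \<open>Strongly irredundant representations\<close>

text \<open>Since all the rings contain \<open>A\<close>, only the elements of \<open>C - A\<close>
  have to be excluded. In this form shrinking a ring, or adding one, clearly preserves a
  representation.\<close>

lemma C_representation_iff:
  assumes "A \<subseteq> C"
  shows "C_representation F A C Y \<longleftrightarrow>
    Y \<subseteq> valuation_overrings F A \<and> (\<forall>x\<in>C - A. \<exists>V\<in>Y. x \<notin> V)"
  using assms unfolding C_representation_def valuation_overrings_def by blast

theorem theorem5p1:
  fixes F :: "('a, 'b) ring_scheme" and A C :: "'a set" and Xs :: "'a set set"
  assumes "field F"
    and "subring A F" and "A \<noteq> carrier F" and "integrally_closed_in F A"
    and "A \<subset> C" and "C \<subseteq> carrier F"
    and "Xs \<subseteq> valuation_overrings F A"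
    and "A = \<Inter>Xs \<inter> C"
    and "noetherian_space (subtopology (zariski F A) Xs)"
  shows "\<exists>Y \<subseteq> gen F A Xs. strongly_irredundant_C_representation F A C Y \<and>
    noetherian_space (subtopology (zariski F A) Y)"
proof -
  note rep_iff = C_representation_iff[OF psubset_imp_subset[OF \<open>A \<subset> C\<close>], of F]
  have unX: "ultra_noetherian Xs"
    by (rule noetherian_imp_ultra_noetherian) (use assms in auto)

  \<comment> \<open>A minimal representation closed under limits and overrings\<close>
  have gen_gen: "gen F A (gen F A Z) \<subseteq> gen F A Z" for Z
    unfolding gen_def by blast
  have gen_rep: "C_representation F A C (gen F A Z)" if "C_representation F A C Z" for Z
    using that unfolding rep_iff gen_def by blast
  \<comment> \<open>Closure under limits makes intersections of chains representations and provides
    minimal members; closure under overrings keeps \<open>G\<close> stable when a ring is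
    enlarged.\<close>
  let ?\<G> = "{G. G \<subseteq> gen F A Xs \<and> ultra_closed G \<and> gen F A G \<subseteq> G \<and> C_representation F A C G}"
  have "\<exists>G\<in>?\<G>. \<forall>H\<in>?\<G>. H \<subseteq> G \<longrightarrow> H = G"
  proof (rule minimal_element_exists)
    have "C_representation F A C Xs"
      using assms by (simp add: C_representation_def)
    then have "gen F A Xs \<in> ?\<G>"
      using ultra_closed_gen[OF \<open>field F\<close> unX] gen_rep gen_gen by simp
    then show "?\<G> \<noteq> {}" by blast
    fix \<C> assume \<C>: "\<C> \<subseteq> ?\<G>" "\<C> \<noteq> {}" "\<And>G H. G \<in> \<C> \<Longrightarrow> H \<in> \<C> \<Longrightarrow> G \<subseteq> H \<or> H \<subseteq> G"
    have "\<exists>V\<in>\<Inter>\<C>. x \<notin> V" if "x \<in> C - A" for x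
    proof (rule ultra_closed_chain_mem)
      show "\<exists>V\<in>G. x \<notin> V" if "G \<in> \<C>" for G
        using \<C>(1) that \<open>x \<in> C - A\<close> by (auto simp: rep_iff)
    qed (use \<C> in auto)
    moreover have "\<Inter>\<C> \<subseteq> gen F A Xs"
      using \<C> by blast
    ultimately have "C_representation F A C (\<Inter>\<C>)"
      by (auto simp: rep_iff gen_def)
    moreover have "gen F A (\<Inter>\<C>) \<subseteq> \<Inter>\<C>"
      using \<C>(1) unfolding gen_def by blast
    moreover have "ultra_closed (\<Inter>\<C>)"
      by (rule ultra_closed_Inter) (use \<C> in auto)
    ultimately have "\<Inter>\<C> \<in> ?\<G>"
      using \<open>\<Inter>\<C> \<subseteq> gen F A Xs\<close> by simp
    then show "\<exists>l\<in>?\<G>. \<forall>G\<in>\<C>. l \<subseteq> G"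
      by blast
  qed
  then obtain G where "G \<in> ?\<G>" and minimal: "\<forall>H\<in>?\<G>. H \<subseteq> G \<longrightarrow> H = G"
    by (rule bexE)
  then have G: "G \<subseteq> gen F A Xs" "ultra_closed G" "gen F A G \<subseteq> G" "C_representation F A C G"
    by simp_all
  have min: "H = G" if "H \<in> ?\<G>" "H \<subseteq> G" for H
    using bspec[OF minimal that(1)] that(2) by (rule mp)

  \<comment> \<open>The minimal members of \<open>G\<close>\<close>
  define Y where "Y = {V \<in> G. \<forall>W\<in>G. W \<subseteq> V \<longrightarrow> W = V}"
  have YG: "Y \<subseteq> G"
    by (auto simp: Y_def)
  have below: "\<exists>M\<in>Y. M \<subseteq> V" if "V \<in> G" for V
    using ultra_closed_minimal_below[OF G(2) that] by (auto simp: Y_def)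
  have anti: "V = W" if "V \<in> Y" "W \<in> Y" "V \<subseteq> W" for V W
    using that by (auto simp: Y_def)
  \<comment> \<open>A ring in \<open>G\<close> that misses \<open>x\<close> contains a minimal one,
    which misses \<open>x\<close> too.\<close>
  have Yrep: "C_representation F A C Y"
    using G(4) below YG unfolding rep_iff by blast
  have unY: "ultra_noetherian Y"
    by (rule ultra_noetherian_antichain[of F Xs A]) (use assms unX YG G anti in auto)
  \<comment> \<open>Otherwise \<open>gen F A Z\<close> would be a competitor inside
    \<open>G\<close>, hence equal to \<open>G\<close>; but \<open>V\<close> belongs to
    \<open>G\<close> and contains no member of \<open>Z\<close>.\<close>
  have not_rep: "\<not> C_representation F A C Z"
    if Z: "ultra_noetherian Z" "Z \<subseteq> G" and V: "V \<in> Y" "\<And>W. W \<in> Z \<Longrightarrow> \<not> W \<subseteq> V" for Z V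
  proof
    assume rep: "C_representation F A C Z"
    have sub: "gen F A Z \<subseteq> G"
      using Z(2) G(3) unfolding gen_def by blast
    have "gen F A Z \<in> ?\<G>"
      using subset_trans[OF sub G(1)] ultra_closed_gen[OF \<open>field F\<close> Z(1)] gen_rep[OF rep] gen_gen
      by simp
    then have "gen F A Z = G"
      using sub by (rule min)
    then show False
      using V YG by (auto simp: gen_def)
  qed

  \<comment> \<open>Strong irredundance of the minimal members\<close>
  have "strongly_irredundant_in F A C Y V" if V: "V \<in> Y" for V
    unfolding strongly_irredundant_in_def irredundant_in_def
  proof (intro conjI notI)
    assume "C_representation F A C (Y - {V})"
    moreover have "\<not> C_representation F A C (Y - {V})"
      using V YG anti by (intro not_rep ultra_noetherian_subset[OF unY]) auto
    ultimately show False by contradiction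
  next
    assume "\<exists>W\<in>valuation_overrings F A. V \<subset> W \<and> C_representation F A C (Y - {V} \<union> {W})"
    then obtain W where W: "W \<in> valuation_overrings F A" "V \<subset> W"
      and rep: "C_representation F A C (Y - {V} \<union> {W})"
      by blast
    have "W \<in> G"
      using W V YG G(3) by (auto simp: gen_def)
    \<comment> \<open>No ring of the modified set lies inside \<open>V\<close>: the old ones because
      \<open>Y\<close> is an antichain, \<open>W\<close> because it is strictly larger.\<close>
    then have "\<not> C_representation F A C (Y - {V} \<union> {W})"
      using V W YG anti
      by (intro not_rep ultra_noetherian_Un ultra_noetherian_singleton
          ultra_noetherian_subset[OF unY]) auto
    with rep show False by contradiction
  qed
  then have "strongly_irredundant_C_representation F A C Y"
    using Yrep by (simp add: strongly_irredundant_C_representation_def)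
  moreover have "noetherian_space (subtopology (zariski F A) Y)"
    by (rule ultra_noetherian_imp_noetherian) (use Yrep unY rep_iff in auto)
  moreover have "Y \<subseteq> gen F A Xs"
    using YG G(1) by blast
  ultimately show ?thesis by blast
qed

end
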